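(* Let $n \in \mathbb{N}$, $n\ge 1$, and $u\ge 0$. In the mixture Cramér–Lundberg model described in the context, let $$\varphi(u) = \frac{1-\rho}{1-\rho^\bullet}\sum_{k=2}^\infty \left(\frac{\epsilon\theta}{1-\rho^\bullet}\right)^k \mathscr{A}_k(u), \qquad \varphi_n(u) = \frac{1-\rho}{1-\rho^\bullet}\sum_{k=2}^n \left(\frac{\epsilon\theta}{1-\rho^\bullet}\right)^k \mathbb{P}\big(\max\{C^e_1,\dots,C^e_k\}>u\big).$$ Then the error of the approximation $\varphi_n(u)$ of $\varphi(u)$ satisfies $$\left(\frac{\epsilon\theta}{1-\rho^\bullet}\right)^{n+1}\mathscr{A}_1(u)\ \le\ \varphi(u)-\varphi_n(u)\ \le\ \left(\frac{\epsilon\theta}{1-\rho^\bullet}\right)^{n+1} + \left(1-\frac{\epsilon\theta}{1-\rho^\bullet}\right)\left(\frac{\epsilon\theta}{1-\rho^\bullet}F_h^e(u)\right)^2 \frac{1-\left(\frac{\epsilon\theta}{1-\rho^\bullet}F_h^e(u)\right)^{n-1}}{1-\frac{\epsilon\theta}{1-\rho^\bullet}F_h^e(u)}.$$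
   Context: A distribution function $F$ on $[0,\infty)$ with tail $\overline F=1-F>0$ is subexponential if $\overline{F^{*n}}(u)\sim n\overline F(u)$ as $u\to\infty$ for every $n\in\mathbb{N}$ ($F^{*n}$ is the $n$-fold convolution). A phase-type distribution is the law of the absorption time of a finite-state Markov jump process with all states but one transient and the remaining one absorbing. Model. Claims arrive according to a Poisson process with rate $\lambda>0$, premium rate is $1$, and claim sizes are i.i.d., independent of the arrivals, with distribution function $G=(1-\epsilon)F_p+\epsilon F_h$, where $\epsilon\in(0,1)$, $F_p$ is the phase-type distribution function of a random variable $B$ with finite mean $\mu_B$, and $F_h$ is the subexponential distribution function of a random variable $C$ with finite mean $\mu_C$. Put $\delta=\lambda\mu_B$, $\theta=\lambda\mu_C$, $\rho^\bullet=(1-\epsilon)\delta$, $\rho=\rho^\bullet+\epsilon\theta$, and assume the net profit condition $\rho<1$. Note $\frac{1-\rho}{1-\rho^\bullet}=1-\frac{\epsilon\theta}{1-\rho^\bullet}$. Stationary excess distributions: $F_p^e(u)=\frac1{\mu_B}\int_0^u(1-F_p(x))\,dx$ and $F_h^e(u)=\frac1{\mu_C}\int_0^u(1-F_h(x))\,dx$. Let $C^e_1,C^e_2,\dots$ be i.i.d. with distribution function $F_h^e$; it is assumed that $F_h^e$ is subexponential. Let $M^\bullet$ be the supremum of the claim surplus process of the compound Poisson risk model with premium rate $1$, arrival rate $(1-\epsilon)\lambda$ and claim size distribution $F_p$; equivalently $\mathbb{P}(M^\bullet\le u)=(1-\rho^\bullet)\sum_{k=0}^\infty(\rho^\bullet)^k(F_p^e)^{*k}(u)$.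 Let $M^\bullet_0,M^\bullet_1,\dots$ be i.i.d. copies of $M^\bullet$, independent of $(C^e_k)_{k\ge1}$. Define $$\mathscr{A}_k(u)=\mathbb{P}\big(M^\bullet_0+M^\bullet_1+\dots+M^\bullet_k+C^e_1+\dots+C^e_k>u\big),\qquad k\ge 1.$$ *)

theory Defs
  imports "HOL-Probability.Probability" "HOL-Library.Landau_Symbols"
begin

subsection \<open>Distribution functions on the nonnegative half-line\<close>

text \<open>Distribution functions are functions on the whole real line that vanish on the negative
  reals, so an atom at \<open>0\<close> shows up as a jump at \<open>0\<close>.\<close>

definition nonneg_df :: "(real \<Rightarrow> real) \<Rightarrow> bool" where
  "nonneg_df F \<longleftrightarrow> mono F \<and> (\<forall>x. continuous (at_right x) F) \<and> (\<forall>x<0. F x = 0) \<and>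
     (F \<longlongrightarrow> 1) at_top"

definition has_df :: "'a measure \<Rightarrow> ('a \<Rightarrow> real) \<Rightarrow> (real \<Rightarrow> real) \<Rightarrow> bool" where
  "has_df M X F \<longleftrightarrow> X \<in> borel_measurable M \<and> (\<forall>x. \<P>(\<omega> in M. X \<omega> \<le> x) = F x)"

definition df_convpow :: "nat \<Rightarrow> (real \<Rightarrow> real) \<Rightarrow> real \<Rightarrow> real" where
  "df_convpow n F = cdf ((convolution (interval_measure F) ^^ n) (return borel 0))"

definition subexponential :: "(real \<Rightarrow> real) \<Rightarrow> bool" where
  "subexponential F \<longleftrightarrow> nonneg_df F \<and> (\<forall>u. 1 - F u > 0) \<and>
     (\<forall>n\<ge>1. (\<lambda>u. 1 - df_convpow n F u) \<sim>[at_top] (\<lambda>u. real n * (1 - F u)))"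

text \<open>The stationary excess distribution function of \<open>F\<close>, where \<open>\<mu>\<close> is the mean of \<open>F\<close>.
  It is \<open>0\<close> for negative arguments, since then the range of integration is empty.\<close>

definition stationary_excess :: "(real \<Rightarrow> real) \<Rightarrow> real \<Rightarrow> real \<Rightarrow> real" where
  "stationary_excess F \<mu> u = 1 / \<mu> * (LBINT x:{0..u}. 1 - F x)"

subsection \<open>Phase-type distributions\<close>

text \<open>A time-homogeneous Markov jump process on a finite state space is a family of probability
  measures \<open>Pr i\<close> (the process started in state \<open>i\<close>) on a common measurable space, together with
  the state \<open>J t \<omega>\<close> at time \<open>t \<ge> 0\<close>. The paths are right-continuous with left limits for the
  discrete topology, i.e. piecewise constant with finitely many jumps in bounded intervals. The
  last clause is the Markov property: given the past up to time \<open>t n\<close>, the state after a further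
  time \<open>h\<close> is distributed as under a restart in the present state.\<close>

definition markov_jump_process :: "('s::finite \<Rightarrow> 'b measure) \<Rightarrow> (real \<Rightarrow> 'b \<Rightarrow> 's) \<Rightarrow> bool" where
  "markov_jump_process Pr J \<longleftrightarrow>
     (\<forall>i. prob_space (Pr i)) \<and> (\<forall>i j. sets (Pr i) = sets (Pr j)) \<and>
     (\<forall>i. \<forall>t\<ge>0. J t \<in> measurable (Pr i) (count_space UNIV)) \<and>
     (\<forall>i. \<forall>\<omega>\<in>space (Pr i).
        (\<forall>t\<ge>0. \<forall>\<^sub>F s in at_right t. J s \<omega> = J t \<omega>) \<and>
        (\<forall>t>0. \<exists>j. \<forall>\<^sub>F s in at_left t. J s \<omega> = j)) \<and>
     (\<forall>i. \<P>(\<omega> in Pr i. J 0 \<omega> = i) = 1) \<and>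
     (\<forall>i n (t :: nat \<Rightarrow> real) j h k. 0 \<le> t 0 \<longrightarrow> mono_on {..n} t \<longrightarrow> 0 \<le> h \<longrightarrow>
        \<P>(\<omega> in Pr i. (\<forall>m\<le>n. J (t m) \<omega> = j m) \<and> J (t n + h) \<omega> = k) =
        \<P>(\<omega> in Pr i. \<forall>m\<le>n. J (t m) \<omega> = j m) * \<P>(\<omega> in Pr (j n). J h \<omega> = k))"

definition absorbing_state :: "('s::finite \<Rightarrow> 'b measure) \<Rightarrow> (real \<Rightarrow> 'b \<Rightarrow> 's) \<Rightarrow> 's \<Rightarrow> bool" where
  "absorbing_state Pr J a \<longleftrightarrow> (\<forall>t\<ge>0. \<P>(\<omega> in Pr a. J t \<omega> = a) = 1)"

definition transient_state :: "('s::finite \<Rightarrow> 'b measure) \<Rightarrow> (real \<Rightarrow> 'b \<Rightarrow> 's) \<Rightarrow> 's \<Rightarrow> bool" where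
  "transient_state Pr J i \<longleftrightarrow> (AE \<omega> in Pr i. bdd_above {t. 0 \<le> t \<and> J t \<omega> = i})"

text \<open>Extended real valued: the time is \<open>\<infinity>\<close> on paths that never reach the state \<open>a\<close>.\<close>

definition absorption_time :: "(real \<Rightarrow> 'b \<Rightarrow> 's) \<Rightarrow> 's \<Rightarrow> 'b \<Rightarrow> ereal" where
  "absorption_time J a \<omega> = (INF t\<in>{t. 0 \<le> t \<and> J t \<omega> = a}. ereal t)"

text \<open>\<open>F\<close> is the distribution function of the absorption time of the process \<open>J\<close> with initial
  distribution \<open>\<alpha>\<close>. The process is an explicit argument because an existential quantifier could not
  range over the types of its states and outcomes; free occurrences of \<open>Pr\<close>, \<open>J\<close>, \<open>a\<close>, \<open>\<alpha>\<close> in a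
  hypothesis amount to ``\<open>F\<close> is of phase type''.\<close>

definition phase_type ::
  "('s::finite \<Rightarrow> 'b measure) \<Rightarrow> (real \<Rightarrow> 'b \<Rightarrow> 's) \<Rightarrow> 's \<Rightarrow> 's pmf \<Rightarrow> (real \<Rightarrow> real) \<Rightarrow> bool" where
  "phase_type Pr J a \<alpha> F \<longleftrightarrow>
     markov_jump_process Pr J \<and> absorbing_state Pr J a \<and> (\<forall>i. i \<noteq> a \<longrightarrow> transient_state Pr J i) \<and>
     (\<forall>x. F x = (\<Sum>i\<in>UNIV. pmf \<alpha> i * \<P>(\<omega> in Pr i. absorption_time J a \<omega> \<le> ereal x)))"

subsection \<open>The compound Poisson risk model\<close>

definition poisson_process :: "'a measure \<Rightarrow> real \<Rightarrow> (real \<Rightarrow> 'a \<Rightarrow> nat) \<Rightarrow> bool" where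
  "poisson_process M r N \<longleftrightarrow> prob_space M \<and> 0 < r \<and>
     (\<forall>t\<ge>0. N t \<in> measurable M (count_space UNIV)) \<and>
     (\<forall>\<omega>\<in>space M. N 0 \<omega> = 0 \<and> mono_on {0..} (\<lambda>t. N t \<omega>) \<and>
        (\<forall>t\<ge>0. \<forall>\<^sub>F s in at_right t. N s \<omega> = N t \<omega>)) \<and>
     (\<forall>s t. 0 \<le> s \<longrightarrow> s < t \<longrightarrow>
        distr M (count_space UNIV) (\<lambda>\<omega>. N t \<omega> - N s \<omega>) = measure_pmf (poisson_pmf (r * (t - s)))) \<and>
     (\<forall>n (t :: nat \<Rightarrow> real). 0 \<le> t 0 \<longrightarrow> mono_on {..n} t \<longrightarrow>
        prob_space.indep_vars M (\<lambda>_. count_space UNIV)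
          (\<lambda>i \<omega>. N (t (Suc i)) \<omega> - N (t i) \<omega>) {..<n})"

text \<open>\<open>N t\<close> counts the claims that arrive up to time \<open>t\<close>, and \<open>U i\<close> with \<open>i \<ge> 1\<close> is the size of
  the \<open>i\<close>-th claim.\<close>

definition compound_poisson_model ::
  "'a measure \<Rightarrow> real \<Rightarrow> (real \<Rightarrow> real) \<Rightarrow> (real \<Rightarrow> 'a \<Rightarrow> nat) \<Rightarrow> (nat \<Rightarrow> 'a \<Rightarrow> real) \<Rightarrow> bool" where
  "compound_poisson_model M r G N U \<longleftrightarrow>
     poisson_process M r N \<and>
     (\<forall>i\<ge>1. has_df M (U i) G) \<and>
     prob_space.indep_vars M (\<lambda>_. borel) U {1..} \<and>
     prob_space.indep_var M
       (Pi\<^sub>M {0..} (\<lambda>_. count_space UNIV)) (\<lambda>\<omega>. \<lambda>t\<in>{0..}. N t \<omega>)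
       (Pi\<^sub>M {1..} (\<lambda>_. borel)) (\<lambda>\<omega>. \<lambda>i\<in>{1..}. U i \<omega>)"

text \<open>The claim surplus process for premium rate \<open>1\<close>.\<close>

definition claim_surplus ::
  "(real \<Rightarrow> 'a \<Rightarrow> nat) \<Rightarrow> (nat \<Rightarrow> 'a \<Rightarrow> real) \<Rightarrow> real \<Rightarrow> 'a \<Rightarrow> real" where
  "claim_surplus N U t \<omega> = (\<Sum>i=1..N t \<omega>. U i \<omega>) - t"

definition claim_surplus_sup ::
  "(real \<Rightarrow> 'a \<Rightarrow> nat) \<Rightarrow> (nat \<Rightarrow> 'a \<Rightarrow> real) \<Rightarrow> 'a \<Rightarrow> ereal" where
  "claim_surplus_sup N U \<omega> = (SUP t\<in>{0..}. ereal (claim_surplus N U t \<omega>))"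

end

theory Submission
  imports Defs
begin

text \<open>Put \<open>q = \<epsilon>\<theta> / (1 - \<rho>\<^sup>\<bullet>) \<in> [0,1)\<close>, so that \<open>(1 - \<rho>) / (1 - \<rho>\<^sup>\<bullet>) = 1 - q\<close>. All summands are almost
  surely nonnegative, hence \<open>\<A>\<^sub>1 \<le> \<A>\<^sub>k \<le> 1\<close> and the maximum of the \<open>C\<^sup>e\<^sub>i\<close> is dominated by the full sum.
  The terms with \<open>k > n\<close> contribute between \<open>q\<^sup>n\<^sup>+\<^sup>1 \<A>\<^sub>1\<close> and \<open>q\<^sup>n\<^sup>+\<^sup>1\<close>; for \<open>2 \<le> k \<le> n\<close> the difference of the
  two probabilities lies between \<open>0\<close> and \<open>P(max \<le> u) = F(u)\<^sup>k\<close> with \<open>F\<close> the distribution function of the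
  \<open>C\<^sup>e\<^sub>i\<close>, which sums to the remaining geometric term.\<close>

lemma has_sum_geometric_atLeast:
  fixes q :: real
  assumes "0 \<le> q" "q < 1"
  shows "((\<lambda>k. q ^ k) has_sum q ^ m / (1 - q)) {m..}"
proof -
  have "(\<lambda>k. q ^ m * q ^ k) sums (q ^ m * (1 / (1 - q)))"
    using assms by (intro sums_mult geometric_sums) auto
  hence "((\<lambda>k. q ^ (m + k)) has_sum (q ^ m / (1 - q))) UNIV"
    using assms by (intro sums_nonneg_imp_has_sum) (auto simp: power_add)
  hence "((\<lambda>k. q ^ k) has_sum (q ^ m / (1 - q))) ((+) m ` UNIV)"
    by (subst has_sum_reindex) (auto simp: o_def)
  moreover have "(+) m ` UNIV = {m..}"
    by (auto simp: image_iff intro: le_Suc_ex)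
  ultimately show ?thesis by simp
qed

text \<open>The analytic half, free of probability: it is applied with \<open>a k\<close> as
  \<open>A k u\<close>, \<open>p k\<close> as the tail of the maximum at \<open>u\<close>, and
  \<open>F\<close> as \<open>Fhe u\<close>.\<close>

lemma geometric_mixture_error_bounds:
  fixes q F :: real and a p :: "nat \<Rightarrow> real"
  assumes q: "0 \<le> q" "q < 1" and F: "0 \<le> F" "F \<le> 1" and n: "1 \<le> n"
    and a: "0 \<le> a 1" "\<And>k. 1 \<le> k \<Longrightarrow> a 1 \<le> a k" "\<And>k. 1 \<le> k \<Longrightarrow> a k \<le> 1"
    and p: "\<And>k. 1 \<le> k \<Longrightarrow> p k = 1 - F ^ k" "\<And>k. 1 \<le> k \<Longrightarrow> p k \<le> a k"
  defines "D \<equiv> (1 - q) * (\<Sum>\<^sub>\<infinity>k\<in>{2..}. q ^ k * a k) - (1 - q) * (\<Sum>k=2..n. q ^ k * p k)"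
  shows "q ^ (n + 1) * a 1 \<le> D"
    and "D \<le> q ^ (n + 1) + (1 - q) * (q * F)\<^sup>2 * ((1 - (q * F) ^ (n - 1)) / (1 - q * F))"
proof -
  let ?g = "\<lambda>k. q ^ k * a k"
  define T where "T = infsum ?g {n+1..}"
  have geo: "((\<lambda>k. q ^ k) has_sum q ^ (n + 1) / (1 - q)) {n+1..}"
    by (rule has_sum_geometric_atLeast[OF q])
  have a0: "0 \<le> a k" if "1 \<le> k" for k
    using a(1) a(2)[OF that] by simp
  have le: "?g k \<le> q ^ k" if "1 \<le> k" for k
    using q a(3)[OF that] by (intro mult_left_le) auto
  \<comment> \<open>This has to be secured first, since \<open>infsum\<close> of a family that is
    not summable is 0 by default.\<close>
  have summable: "?g summable_on {n+1..}"
    by (rule summable_on_comparison_test[OF has_sum_imp_summable[OF geo]])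
      (use q a0 le in auto)
  have T: "(?g has_sum T) {n+1..}"
    unfolding T_def using summable by (rule has_sum_infsum)
  \<comment> \<open>The denominator \<open>1 - q\<close> in both bounds on \<open>T\<close> cancels
    against the prefactor of \<open>D\<close>, leaving a pure power of \<open>q\<close>.\<close>
  have T_le: "T \<le> q ^ (n + 1) / (1 - q)"
    by (rule has_sum_mono[OF T geo]) (use le in auto)
  have T_ge: "q ^ (n + 1) / (1 - q) * a 1 \<le> T"
    by (rule has_sum_mono[OF has_sum_cmult_left[OF geo] T])
      (use q a(2) in \<open>auto intro!: mult_left_mono\<close>)
  have "{2..} = {2..n} \<union> {n+1..}" using n by auto
  hence "infsum ?g {2..} = sum ?g {2..n} + T"
    using infsum_Un_disjoint[of ?g "{2..n}" "{n+1..}"] summable by (auto simp: T_def)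
  hence D: "D = (1 - q) * T + (1 - q) * (\<Sum>k=2..n. q ^ k * (a k - p k))"
    by (simp add: D_def algebra_simps sum_subtractf)
  have "q ^ (n + 1) * a 1 \<le> (1 - q) * T"
    using mult_left_mono[OF T_ge, of "1 - q"] q by simp
  moreover have "0 \<le> (1 - q) * (\<Sum>k=2..n. q ^ k * (a k - p k))"
    using q p(2) by (intro mult_nonneg_nonneg sum_nonneg) auto
  ultimately show "q ^ (n + 1) * a 1 \<le> D" unfolding D by simp
  have tail: "(1 - q) * T \<le> q ^ (n + 1)"
    using mult_left_mono[OF T_le, of "1 - q"] q by simp
  have "(\<Sum>k=2..n. q ^ k * (a k - p k)) \<le> (\<Sum>k=2..n. (q * F) ^ k)"
    unfolding power_mult_distrib using q a(3) p(1) by (intro sum_mono mult_left_mono) auto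
  also have "q * F < 1"
    using mult_left_le[OF F(2) q(1)] q by simp
  hence "(\<Sum>k=2..n. (q * F) ^ k) = (q * F)\<^sup>2 * ((1 - (q * F) ^ (n - 1)) / (1 - q * F))"
  \<comment> \<open>For \<open>n = 1\<close> the sum is empty and the exponent \<open>n - 1\<close>
    is 0, so both sides vanish. Otherwise \<open>n = 2 + j\<close> gives the range the shape
    \<open>{2..2+j}\<close> that \<open>sum_gp_offset\<close> expects.\<close>
  proof (cases "n = 1")
    case False
    with n obtain j where "n = 2 + j" using le_Suc_ex[of 2 n] by auto
    thus ?thesis using \<open>q * F < 1\<close>
      by (simp only: sum_gp_offset) simp
  qed simp
  finally have "(1 - q) * (\<Sum>k=2..n. q ^ k * (a k - p k))
      \<le> (1 - q) * ((q * F)\<^sup>2 * ((1 - (q * F) ^ (n - 1)) / (1 - q * F)))"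
    using q by (intro mult_left_mono) auto
  with tail show "D \<le> q ^ (n + 1) +
      (1 - q) * (q * F)\<^sup>2 * ((1 - (q * F) ^ (n - 1)) / (1 - q * F))"
    unfolding D by (simp only: mult.assoc)
qed

text \<open>The event \<open>X < 0\<close> is a countable union of the events
  \<open>X \<le> -1/(j+1)\<close>, each null because \<open>F\<close> vanishes at negative
  points.\<close>

lemma (in prob_space) AE_nonneg_if_has_df:
  assumes X: "has_df M X F" and F: "\<And>x. x < 0 \<Longrightarrow> F x = 0"
  shows "AE \<omega> in M. 0 \<le> X \<omega>"
proof -
  have [measurable]: "X \<in> borel_measurable M"
    using X by (simp add: has_df_def)
  have "AE \<omega> in M. \<forall>j. \<not> X \<omega> \<le> - inverse (real (Suc j))"
  proof (subst AE_all_countable, intro allI)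
    fix j
    have "prob {\<omega> \<in> space M. X \<omega> \<le> - inverse (real (Suc j))} = 0"
      using X F[of "- inverse (real (Suc j))"] by (simp add: has_df_def)
    thus "AE \<omega> in M. \<not> X \<omega> \<le> - inverse (real (Suc j))"
      by (subst (asm) prob_eq_0) auto
  qed
  thus ?thesis
  proof eventually_elim
    case (elim \<omega>)
    show ?case
    proof (rule ccontr)
      assume "\<not> 0 \<le> X \<omega>"
      then obtain j where "inverse (real (Suc j)) < - X \<omega>"
        using reals_Archimedean[of "- X \<omega>"] by auto
      thus False using elim[rule_format, of j] by simp
    qed
  qed
qed

text \<open>The maximum stays below \<open>u\<close> exactly when every \<open>X i\<close> does, and
  independence turns this intersection into a product of equal factors.\<close>

lemma (in prob_space) prob_Max_greater_iid:
  fixes X :: "'i \<Rightarrow> 'a \<Rightarrow> real"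
  assumes X: "\<And>i. i \<in> I \<Longrightarrow> has_df M (X i) F"
    and indep: "indep_vars (\<lambda>_. borel) X I" and I: "finite I" "I \<noteq> {}"
  shows "\<P>(\<omega> in M. Max ((\<lambda>i. X i \<omega>) ` I) > u) = 1 - F u ^ card I"
proof -
  have [measurable]: "X i \<in> borel_measurable M" if "i \<in> I" for i
    using X[OF that] by (simp add: has_df_def)
  let ?E = "\<Inter>i\<in>I. X i -` {..u} \<inter> space M"
  have "prob ?E = (\<Prod>i\<in>I. prob (X i -` {..u} \<inter> space M))"
    by (rule indep_varsD[OF indep]) (use I in auto)
  also have "\<dots> = (\<Prod>i\<in>I. F u)"
  proof (rule prod.cong)
    fix i assume "i \<in> I"
    moreover have "X i -` {..u} \<inter> space M = {\<omega> \<in> space M. X i \<omega> \<le> u}" by auto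
    ultimately show "prob (X i -` {..u} \<inter> space M) = F u"
      using X by (simp add: has_df_def)
  qed simp
  finally have "prob ?E = F u ^ card I" by simp
  moreover have "?E \<in> events" using I by (intro sets.finite_INT) auto
  moreover have "{\<omega> \<in> space M. Max ((\<lambda>i. X i \<omega>) ` I) > u} = space M - ?E"
    using I by (auto simp: Max_gr_iff not_le)
  ultimately show ?thesis by (simp add: prob_compl)
qed

text \<open>At time 0 no claim has arrived, so the surplus there is 0.\<close>

lemma claim_surplus_sup_nonneg:
  assumes "compound_poisson_model M r G N U" "\<omega> \<in> space M"
  shows "0 \<le> claim_surplus_sup N U \<omega>"
proof -
  have "N 0 \<omega> = 0"
    using assms by (simp add: compound_poisson_model_def poisson_process_def)
  hence "claim_surplus N U 0 \<omega> = 0" by (simp add: claim_surplus_def)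
  thus ?thesis unfolding claim_surplus_sup_def
    by (intro SUP_upper2[of 0]) auto
qed

lemma subexponential_neg: "subexponential F \<Longrightarrow> x < 0 \<Longrightarrow> F x = 0"
  by (simp add: subexponential_def nonneg_df_def)

theorem proposition3p2:
  fixes lam \<epsilon> \<mu>B \<mu>C \<delta> \<theta> \<rho>b \<rho> u :: real and n :: nat
    and Fp Fh G Fhe :: "real \<Rightarrow> real"
    and Pr :: "'s::finite \<Rightarrow> 'b measure" and J :: "real \<Rightarrow> 'b \<Rightarrow> 's" and a :: 's and \<alpha> :: "'s pmf"
    and M0 :: "'c measure" and N :: "real \<Rightarrow> 'c \<Rightarrow> nat" and U :: "nat \<Rightarrow> 'c \<Rightarrow> real"
    and B C :: "'c \<Rightarrow> real"
    and Mb :: "'d measure" and Nb :: "real \<Rightarrow> 'd \<Rightarrow> nat" and Ub :: "nat \<Rightarrow> 'd \<Rightarrow> real"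
    and M :: "'a measure" and S Ce :: "nat \<Rightarrow> 'a \<Rightarrow> real"
    and A :: "nat \<Rightarrow> real \<Rightarrow> real" and \<phi> :: "real \<Rightarrow> real" and \<phi>\<^sub>n :: "nat \<Rightarrow> real \<Rightarrow> real"
  \<comment> \<open>the mixture model and its parameters\<close>
  assumes lam: "0 < lam" and eps: "0 < \<epsilon>" "\<epsilon> < 1"
    and Fp: "phase_type Pr J a \<alpha> Fp"
    and Fh: "subexponential Fh"
    and G: "\<And>x. G x = (1 - \<epsilon>) * Fp x + \<epsilon> * Fh x"
    and model: "compound_poisson_model M0 lam G N U"
    and B: "has_df M0 B Fp" "integrable M0 B" "\<mu>B = integral\<^sup>L M0 B"
    and C: "has_df M0 C Fh" "integrable M0 C" "\<mu>C = integral\<^sup>L M0 C"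
    and params: "\<delta> = lam * \<mu>B" "\<theta> = lam * \<mu>C" "\<rho>b = (1 - \<epsilon>) * \<delta>" "\<rho> = \<rho>b + \<epsilon> * \<theta>"
    and net_profit: "\<rho> < 1"
    and Fhe: "Fhe = stationary_excess Fh \<mu>C" "subexponential Fhe"
  \<comment> \<open>the risk model with phase-type claims only, whose surplus supremum is copied by \<open>S\<close>\<close>
    and base_model: "compound_poisson_model Mb ((1 - \<epsilon>) * lam) Fp Nb Ub"
    and M: "prob_space M"
    and S: "\<And>k. has_df M (S k) (\<lambda>x. \<P>(\<omega> in Mb. claim_surplus_sup Nb Ub \<omega> \<le> ereal x))"
    and Ce: "\<And>k. 1 \<le> k \<Longrightarrow> has_df M (Ce k) Fhe"
    and indep: "prob_space.indep_vars M (\<lambda>_. borel) (case_sum S Ce) (range Inl \<union> Inr ` {1..})"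
    and A: "\<And>k v. 1 \<le> k \<Longrightarrow> A k v = \<P>(\<omega> in M. (\<Sum>i=0..k. S i \<omega>) + (\<Sum>i=1..k. Ce i \<omega>) > v)"
    and \<phi>: "\<And>v. \<phi> v = (1 - \<rho>) / (1 - \<rho>b) *
              (\<Sum>\<^sub>\<infinity>k\<in>{2..}. (\<epsilon> * \<theta> / (1 - \<rho>b)) ^ k * A k v)"
    and \<phi>\<^sub>n: "\<And>m v. \<phi>\<^sub>n m v = (1 - \<rho>) / (1 - \<rho>b) *
              (\<Sum>k=2..m. (\<epsilon> * \<theta> / (1 - \<rho>b)) ^ k * \<P>(\<omega> in M. Max ((\<lambda>i. Ce i \<omega>) ` {1..k}) > v))"
    and n: "1 \<le> n" and u: "0 \<le> u"
  shows "(\<epsilon> * \<theta> / (1 - \<rho>b)) ^ (n + 1) * A 1 u \<le> \<phi> u - \<phi>\<^sub>n n u \<and>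
         \<phi> u - \<phi>\<^sub>n n u \<le>
           (\<epsilon> * \<theta> / (1 - \<rho>b)) ^ (n + 1) +
           (1 - \<epsilon> * \<theta> / (1 - \<rho>b)) * (\<epsilon> * \<theta> / (1 - \<rho>b) * Fhe u)\<^sup>2 *
             ((1 - (\<epsilon> * \<theta> / (1 - \<rho>b) * Fhe u) ^ (n - 1)) / (1 - \<epsilon> * \<theta> / (1 - \<rho>b) * Fhe u))"
proof -
  interpret M: prob_space M by (rule M)
  interpret M0: prob_space M0
    using model by (simp add: compound_poisson_model_def poisson_process_def)
  define q where "q = \<epsilon> * \<theta> / (1 - \<rho>b)"
  \<comment> \<open>The sign of \<theta> rests on this; it gives
    \<open>\<rho>b \<le> \<rho> < 1\<close>, so the denominator in \<open>q\<close> is positive, and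
    \<open>q < 1\<close> is then the net profit condition rearranged.\<close>
  have "0 \<le> \<mu>C"
    using M0.AE_nonneg_if_has_df[OF C(1) subexponential_neg[OF Fh]]
    unfolding C(3) by (rule integral_nonneg_AE)
  hence \<theta>: "0 \<le> \<epsilon> * \<theta>" using lam eps by (simp add: params)
  have \<rho>b: "\<rho>b < 1" using net_profit \<theta> by (simp add: params(4))
  have q: "0 \<le> q" "q < 1" and one_minus_q: "(1 - \<rho>) / (1 - \<rho>b) = 1 - q"
    using \<rho>b \<theta> net_profit by (auto simp: q_def params(4) field_simps)

  have meas [measurable]: "S i \<in> borel_measurable M" for i
    using S[of i] by (simp add: has_df_def)
  have measC [measurable]: "Ce i \<in> borel_measurable M" if "1 \<le> i" for i
    using Ce[OF that] by (simp add: has_df_def)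
  \<comment> \<open>\<open>S i\<close> lives on another space than the surplus process, so
    nonnegativity is carried over through the distribution function.\<close>
  have S_nonneg: "AE \<omega> in M. 0 \<le> S i \<omega>" for i
  proof (rule M.AE_nonneg_if_has_df[OF S])
    fix x :: real assume x: "x < 0"
    have "{\<omega> \<in> space Mb. claim_surplus_sup Nb Ub \<omega> \<le> ereal x} = {}"
      using claim_surplus_sup_nonneg[OF base_model] x
      by (auto simp: not_le intro: order.strict_trans2[of "ereal x" 0])
    thus "\<P>(\<omega> in Mb. claim_surplus_sup Nb Ub \<omega> \<le> ereal x) = 0"
      by (metis measure_empty)
  qed
  \<comment> \<open>Nothing is known about \<open>Ce 0\<close>; the guard inside the
    almost-everywhere statement lets \<open>i\<close> range over all naturals when the null sets are
    united.\<close>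
  have Ce_nonneg: "AE \<omega> in M. 1 \<le> i \<longrightarrow> 0 \<le> Ce i \<omega>" for i
    by (cases "1 \<le> i") (use M.AE_nonneg_if_has_df[OF Ce subexponential_neg[OF Fhe(2)]] in auto)
  have nonneg: "AE \<omega> in M. (\<forall>i. 0 \<le> S i \<omega>) \<and> (\<forall>i\<ge>1. 0 \<le> Ce i \<omega>)"
    using S_nonneg Ce_nonneg by (simp add: AE_all_countable AE_conj_iff)

  define p where "p k = \<P>(\<omega> in M. Max ((\<lambda>i. Ce i \<omega>) ` {1..k}) > u)" for k
  have p_eq: "p k = 1 - Fhe u ^ k" if "1 \<le> k" for k
  proof -
    \<comment> \<open>Independence is given for the joint family over a sum type; its
      \<open>Inr\<close> part is the claims alone, and \<open>Inr\<close> being injective keeps the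
      exponent \<open>k\<close>.\<close>
    have "M.indep_vars (\<lambda>_. borel) (case_sum S Ce) (Inr ` {1..k})"
      by (rule M.indep_vars_subset[OF indep]) auto
    moreover have "has_df M (case_sum S Ce i) Fhe" if "i \<in> Inr ` {1..k}" for i
      using that Ce by auto
    ultimately show ?thesis
      using M.prob_Max_greater_iid[of "Inr ` {1..k}" "case_sum S Ce" Fhe u] that
      by (simp add: p_def image_image card_image)
  qed
  have A_meas: "{\<omega> \<in> space M. (\<Sum>i=0..k. S i \<omega>) + (\<Sum>i=1..k. Ce i \<omega>) > u} \<in> sets M" for k
    by measurable
  have A_mono: "A 1 u \<le> A k u" if k: "1 \<le> k" for k
    unfolding A[OF k] A[OF order.refl]
  proof (rule M.finite_measure_mono_AE[OF _ A_meas], use nonneg in eventually_elim)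
    case (elim \<omega>)
    have "(\<Sum>i=0..1. S i \<omega>) \<le> (\<Sum>i=0..k. S i \<omega>)" "(\<Sum>i=1..1. Ce i \<omega>) \<le> (\<Sum>i=1..k. Ce i \<omega>)"
      using elim k by (intro sum_mono2; simp)+
    thus ?case by auto
  qed
  have p_le: "p k \<le> A k u" if k: "1 \<le> k" for k
    unfolding A[OF k] p_def
  proof (rule M.finite_measure_mono_AE[OF _ A_meas], use nonneg in eventually_elim)
    case (elim \<omega>)
    have "Max ((\<lambda>i. Ce i \<omega>) ` {1..k}) \<le> (\<Sum>i=1..k. Ce i \<omega>)"
      using elim k by (subst Max_le_iff) (auto intro!: member_le_sum)
    moreover have "0 \<le> (\<Sum>i=0..k. S i \<omega>)" using elim by (auto intro: sum_nonneg)
    ultimately show ?case by auto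
  qed
  have A_le: "0 \<le> A k u" "A k u \<le> 1" if "1 \<le> k" for k
    using that by (auto simp: A)
  \<comment> \<open>Reading \<open>Fhe u\<close> as a probability bounds it without evaluating the
    integral that defines it.\<close>
  have "Fhe u = \<P>(\<omega> in M. Ce 1 \<omega> \<le> u)" using Ce[of 1] by (simp add: has_df_def)
  hence F: "0 \<le> Fhe u" "Fhe u \<le> 1" by simp_all
  show ?thesis
    using geometric_mixture_error_bounds[of q "Fhe u" n "\<lambda>k. A k u" p]
      q F n A_le A_mono p_eq p_le
    unfolding \<phi> \<phi>\<^sub>n one_minus_q p_def[symmetric] q_def[symmetric] by simp
qed

end
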